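(* Consider the system $x^+=f(x,u,w)$, stage cost $\ell$, set $\mathbb{Z}_g$ and horizon $N\ge1$ described in the context, with steady-state pair $(x_s,u_s)=(0,0)$. Suppose: (i) $f:\mathbb{X}\times\mathbb{U}\times\mathbb{W}\to\mathbb{X}$ and $\ell:\mathbb{X}\times\mathbb{U}\to\mathbb{R}$ are continuous; $\mathbb{U}$ is compact and $\mathbb{X}$ is closed; $(0,0)\in\mathbb{X}\times\mathbb{U}$ and $f(0,0,0)=0$; (ii) $(x,u)\mapsto f(x,u,0)$ and $\ell$ are twice continuously differentiable in the interior of $\mathbb{Z}_g$; the linearized system $x^+=Ax+Bu$ with $A:=\frac{\partial f}{\partial x}(0,0,0)$, $B:=\frac{\partial f}{\partial u}(0,0,0)$ is stabilizable; and $\mathbb{U}$ and $\mathbb{Z}_g$ contain the origin in their interiors. Let $K\in\mathbb{R}^{m\times n}$ be such that $A_K:=A+BK$ is Schur stable, let $\tilde Q\succ0$, let $\tilde P\succ0$ solve $A_K'\tilde PA_K-\tilde P+\tilde Q=0$, and let $V_s(x):=x'\tilde Px$. For $\tau>0$ let $\mathbb{X}_f:=\{x\in\mathbb{X}\mid V_s(x)\le\tau\}$, where $\tau$ is required to be such that $Kx\in\mathbb{U}$ and $(x,Kx)\in\mathbb{Z}_g$ for all $x\in\mathbb{X}_f$; suppose also that for such terminal sets the feasible set $\mathcal{X}$ is bounded. Let $\bar\ell(x):=\ell(x,Kx)-\ell(0,0)$ and $q:=\nabla\bar\ell(0)$. Given $\mathbb{X}_f$, let $Q\in\mathbb{R}^{n\times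 n}$ be a symmetric (possibly indefinite) matrix such that $x'(Q-\nabla^2\bar\ell(x))x\ge0$ for all $x\in\mathbb{X}_f$, let $P$ and $p$ be defined by $A_K'PA_K-P+Q=0$ and $p'=q'(I-A_K)^{-1}$, let $V_e(x):=x'Px+p'x$, and for $\mu\ge0$ let $V_f(x):=\mu V_s(x)+V_e(x)$. Then there exist $\tau>0$ (as required above) and $\mu\ge0$ such that $\kappa_f(x)=Kx$, $V_s$, $\mathbb{X}_f$ and $V_f$ satisfy the following robust terminal condition: there is a set $\mathbb{X}_s\subseteq\mathbb{X}$ with $0\in\mathbb{X}_s$ and $\mathbb{X}_f\subseteq\mathbb{X}_s$ such that $\kappa_f$ maps $\mathbb{X}_s$ into $\mathbb{U}$, $\mathbb{X}_s$ is positive invariant for $x^+=f(x,\kappa_f(x),0)$, $V_s$ is a continuous Lyapunov function for $x^+=f(x,\kappa_f(x),0)$ on $\mathbb{X}_s$ with respect to the steady state $0$, and $V_f$ is continuous and satisfies $$V_f(f(x,\kappa_f(x),0))\le V_f(x)-\ell(x,\kappa_f(x))+\ell(0,0)\qquad\text{for all }x\in\mathbb{X}_f.$$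
   Context: System: $x^+=f(x,u,w)$ with $f:\mathbb{X}\times\mathbb{U}\times\mathbb{W}\to\mathbb{X}$, $\mathbb{X}\subseteq\mathbb{R}^n$, $\mathbb{U}\subseteq\mathbb{R}^m$, $\mathbb{W}\subseteq\mathbb{R}^q$, $0\in\mathbb{W}$. Stage cost: $\ell(x,u)=\ell_e(x,u)+\lambda\max\{g(x,u),0\}$ with $\ell_e:\mathbb{X}\times\mathbb{U}\to\mathbb{R}$, $g:\mathbb{X}\times\mathbb{U}\to\mathbb{R}$ continuous, $\lambda>0$; and $\mathbb{Z}_g:=\{(x,u)\in\mathbb{X}\times\mathbb{U}\mid g(x,u)\le0\}$. Feasible set: for $\mathbf{u}\in\mathbb{U}^N$, $\hat\phi(N;x,\mathbf{u})$ is the state at time $N$ of $x^+=f(x,u,0)$ from $x\in\mathbb{X}$ under the input sequence $\mathbf{u}$; $\mathcal{X}:=\{x\in\mathbb{X}\mid\exists\,\mathbf{u}\in\mathbb{U}^N:\hat\phi(N;x,\mathbf{u})\in\mathbb{X}_f\}$. Definitions. $'$ denotes transpose; $\succ0$ denotes symmetric positive definite; a matrix is Schur stable if all its eigenvalues lie strictly inside the unit circle. $\nabla$ and $\nabla^2$ denote gradient and Hessian. $\alpha:\mathbb{R}_{\ge0}\to\mathbb{R}_{\ge0}$ is in class $\mathcal{K}_\infty$ if it is continuous, strictly increasing, $\alpha(0)=0$ and $\lim_{s\to\infty}\alpha(s)=\infty$. A set $X$ is positive invariant for $x^+=f(x)$ if $f(x)\in X$ for all $x\in X$. A function $V\ge0$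 is a Lyapunov function for $x^+=f(x)$ on the positive invariant set $X$ with respect to the steady state $x_s$ if there exist $\alpha_1,\alpha_2,\alpha_3\in\mathcal{K}_\infty$ such that $\alpha_1(|x-x_s|)\le V(x)\le\alpha_2(|x-x_s|)$ and $V(f(x))\le V(x)-\alpha_3(|x-x_s|)$ for all $x\in X$, with $|\cdot|$ the Euclidean norm. Order of choices: $K$, $\tilde Q$ (hence $\tilde P$, $V_s$) are fixed first; then $\tau$ (hence $\mathbb{X}_f$); then $Q$ is any matrix with the stated property on that $\mathbb{X}_f$ (hence $P$, $p$, $V_e$); then $\mu$. *)

theory Defs
  imports "HOL-Analysis.Analysis"
begin

(* Intended for open S; the first and second derivatives are Frechet derivatives. *)
definition C2_on :: "'a::real_normed_vector set \<Rightarrow> ('a \<Rightarrow> 'b::real_normed_vector) \<Rightarrow> bool" where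
  "C2_on S F \<longleftrightarrow>
     (\<exists>(D1 :: 'a \<Rightarrow> 'a \<Rightarrow>\<^sub>L 'b) (D2 :: 'a \<Rightarrow> 'a \<Rightarrow>\<^sub>L ('a \<Rightarrow>\<^sub>L 'b)).
        (\<forall>x\<in>S. (F has_derivative blinfun_apply (D1 x)) (at x)) \<and>
        (\<forall>x\<in>S. (D1 has_derivative blinfun_apply (D2 x)) (at x)) \<and>
        continuous_on S D2)"

definition grad :: "(real^'n \<Rightarrow> real) \<Rightarrow> real^'n \<Rightarrow> real^'n" where
  "grad \<phi> x = (SOME d. GDERIV \<phi> x :> d)"

definition hessian :: "(real^'n \<Rightarrow> real) \<Rightarrow> real^'n \<Rightarrow> real^'n^'n" where
  "hessian \<phi> x = jacobian (grad \<phi>) (at x)"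

(* The condition under which the value of hessian at x is meaningful. *)
definition twice_differentiable_at :: "(real^'n \<Rightarrow> real) \<Rightarrow> real^'n \<Rightarrow> bool" where
  "twice_differentiable_at \<phi> x \<longleftrightarrow>
     (\<forall>\<^sub>F y in nhds x. \<phi> differentiable (at y)) \<and> grad \<phi> differentiable (at x)"

definition pos_def :: "real^'n^'n \<Rightarrow> bool" where
  "pos_def M \<longleftrightarrow> transpose M = M \<and> (\<forall>x. x \<noteq> 0 \<longrightarrow> 0 < x \<bullet> (M *v x))"

(* The eigenvalues of a real matrix are taken over the complex numbers. *)
definition eigenvalue :: "real^'n^'n \<Rightarrow> complex \<Rightarrow> bool" where
  "eigenvalue M c \<longleftrightarrow>
     (\<exists>v :: complex^'n. v \<noteq> 0 \<and> (\<chi> i j. complex_of_real (M $ i $ j)) *v v = c *s v)"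

definition schur_stable :: "real^'n^'n \<Rightarrow> bool" where
  "schur_stable M \<longleftrightarrow> (\<forall>c. eigenvalue M c \<longrightarrow> norm c < 1)"

definition stabilizable :: "real^'n^'n \<Rightarrow> real^'m^'n \<Rightarrow> bool" where
  "stabilizable A B \<longleftrightarrow> (\<exists>K :: real^'n^'m. schur_stable (A + B ** K))"

definition class_K_inf :: "(real \<Rightarrow> real) \<Rightarrow> bool" where
  "class_K_inf \<alpha> \<longleftrightarrow> continuous_on {0..} \<alpha> \<and> strict_mono_on {0..} \<alpha> \<and> \<alpha> 0 = 0 \<and>
     filterlim \<alpha> at_top at_top"

definition positive_invariant :: "('a \<Rightarrow> 'a) \<Rightarrow> 'a set \<Rightarrow> bool" where
  "positive_invariant F S \<longleftrightarrow> (\<forall>x\<in>S. F x \<in> S)"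

definition lyapunov_function ::
    "('a::real_normed_vector \<Rightarrow> real) \<Rightarrow> ('a \<Rightarrow> 'a) \<Rightarrow> 'a set \<Rightarrow> 'a \<Rightarrow> bool" where
  "lyapunov_function V F S xs \<longleftrightarrow>
     positive_invariant F S \<and> (\<forall>x\<in>S. 0 \<le> V x) \<and>
     (\<exists>\<alpha>\<^sub>1 \<alpha>\<^sub>2 \<alpha>\<^sub>3. class_K_inf \<alpha>\<^sub>1 \<and> class_K_inf \<alpha>\<^sub>2 \<and> class_K_inf \<alpha>\<^sub>3 \<and>
        (\<forall>x\<in>S. \<alpha>\<^sub>1 (norm (x - xs)) \<le> V x \<and> V x \<le> \<alpha>\<^sub>2 (norm (x - xs)) \<and>
                V (F x) \<le> V x - \<alpha>\<^sub>3 (norm (x - xs))))"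

(* State at time k of the nominal system (zero disturbance). *)
fun nominal_state :: "('x \<Rightarrow> 'u \<Rightarrow> 'w::zero \<Rightarrow> 'x) \<Rightarrow> nat \<Rightarrow> 'x \<Rightarrow> (nat \<Rightarrow> 'u) \<Rightarrow> 'x" where
  "nominal_state f 0 x us = x"
| "nominal_state f (Suc k) x us = f (nominal_state f k x us) (us k) 0"

(* Only the first N entries of the input sequence matter. *)
definition feasible_set ::
    "('x \<Rightarrow> 'u \<Rightarrow> 'w::zero \<Rightarrow> 'x) \<Rightarrow> 'x set \<Rightarrow> 'u set \<Rightarrow> nat \<Rightarrow> 'x set \<Rightarrow> 'x set" where
  "feasible_set f X U N Xf =
     {x \<in> X. \<exists>us. (\<forall>k<N. us k \<in> U) \<and> nominal_state f N x us \<in> Xf}"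

definition robust_terminal_condition ::
    "(real^'n \<Rightarrow> real^'m \<Rightarrow> real^'q \<Rightarrow> real^'n) \<Rightarrow> (real^'n) set \<Rightarrow> (real^'m) set \<Rightarrow>
     (real^'n \<Rightarrow> real^'m \<Rightarrow> real) \<Rightarrow> (real^'n \<Rightarrow> real^'m) \<Rightarrow> (real^'n \<Rightarrow> real) \<Rightarrow>
     (real^'n) set \<Rightarrow> (real^'n \<Rightarrow> real) \<Rightarrow> bool" where
  "robust_terminal_condition f X U l \<kappa> Vs Xf Vf \<longleftrightarrow>
     (\<exists>Xs. Xs \<subseteq> X \<and> 0 \<in> Xs \<and> Xf \<subseteq> Xs \<and>
        \<kappa> ` Xs \<subseteq> U \<and>
        positive_invariant (\<lambda>x. f x (\<kappa> x) 0) Xs \<and>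
        continuous_on Xs Vs \<and>
        lyapunov_function Vs (\<lambda>x. f x (\<kappa> x) 0) Xs 0) \<and>
     continuous_on X Vf \<and>
     (\<forall>x\<in>Xf. Vf (f x (\<kappa> x) 0) \<le> Vf x - l x (\<kappa> x) + l 0 0)"

end

theory Submission
  imports Defs
begin

text \<open>
  Near the origin the closed loop is \<open>G x = A\<^sub>K x + r x\<close> with \<open>r x = O(|x|\<^sup>2)\<close>. Hence
  \<open>V\<^sub>s (G x) - V\<^sub>s x = - x' Q\<^sub>s x + O(|x|\<^sup>3)\<close>, which is at most \<open>- c |x|\<^sup>2\<close> on a small sublevel set
  of \<open>V\<^sub>s\<close>; this sublevel set serves both as \<open>X\<^sub>f\<close> and as \<open>X\<^sub>s\<close>. Since \<open>p' (A\<^sub>K - I) = - q'\<close>, the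
  first-order parts of \<open>V\<^sub>e (G x) - V\<^sub>e x\<close> and of \<open>- lbar x\<close> agree, so their difference is
  \<open>O(|x|\<^sup>2)\<close> and is absorbed by \<open>\<mu> (V\<^sub>s (G x) - V\<^sub>s x)\<close> for large \<open>\<mu>\<close>.
\<close>

section \<open>Twice continuously differentiable maps\<close>

text \<open>The chain rule applied twice; \<open>T\<close> is its own derivative, so no second-order
  term of \<open>T\<close> arises. This transfers smoothness in the pair (x, u) to the closed loop u
  = K x.\<close>

lemma C2_on_compose_bounded_linear:
  fixes F :: "'a::real_normed_vector \<Rightarrow> 'b::real_normed_vector"
    and T :: "'c::real_normed_vector \<Rightarrow> 'a"
  assumes F: "C2_on S F" and T: "bounded_linear T"
  shows "C2_on (T -` S) (\<lambda>x. F (T x))"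
proof -
  obtain D1 D2 where
    D1: "\<And>x. x \<in> S \<Longrightarrow> (F has_derivative blinfun_apply (D1 x)) (at x)" and
    D2: "\<And>x. x \<in> S \<Longrightarrow> (D1 has_derivative blinfun_apply (D2 x)) (at x)" and
    cont: "continuous_on S D2"
    using F unfolding C2_on_def by blast
  define t where "t = Blinfun T"
  have t: "blinfun_apply t = T"
    unfolding t_def by (simp add: T bounded_linear_Blinfun_apply)
  \<comment> \<open>\<open>R\<close> is precomposition with \<open>T\<close> as an operator on first
    derivatives. With it the second derivative becomes a composition of bounded linear maps, whose
    continuity follows from that of \<open>D2\<close>.\<close>
  define R :: "('a \<Rightarrow>\<^sub>L 'b) \<Rightarrow>\<^sub>L ('c \<Rightarrow>\<^sub>L 'b)" where "R = Blinfun (\<lambda>L. L o\<^sub>L t)"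
  have bl: "bounded_linear (\<lambda>L :: 'a \<Rightarrow>\<^sub>L 'b. L o\<^sub>L t)"
    by (rule bounded_bilinear.bounded_linear_left[OF bounded_bilinear_blinfun_compose])
  have R: "blinfun_apply R = (\<lambda>L. L o\<^sub>L t)"
    unfolding R_def by (simp add: bl bounded_linear_Blinfun_apply)
  have Tder: "(T has_derivative T) (at x)" for x
    by (rule bounded_linear_imp_has_derivative[OF T])
  have "((\<lambda>x. F (T x)) has_derivative blinfun_apply (D1 (T x) o\<^sub>L t)) (at x)" if "T x \<in> S" for x
    using has_derivative_compose[OF Tder D1[OF that]] by (simp add: t o_def blinfun_compose.rep_eq)
  moreover have "((\<lambda>x. D1 (T x) o\<^sub>L t) has_derivative blinfun_apply (R o\<^sub>L (D2 (T x) o\<^sub>L t))) (at x)"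
    if "T x \<in> S" for x
    using bounded_linear.has_derivative[OF bl has_derivative_compose[OF Tder D2[OF that]]]
    by (simp add: t R o_def blinfun_compose.rep_eq)
  moreover have "continuous_on (T -` S) (\<lambda>x. R o\<^sub>L (D2 (T x) o\<^sub>L t))"
  proof -
    have "continuous_on (T -` S) (\<lambda>x. D2 (T x))"
      by (rule continuous_on_compose2[OF cont]) (auto intro: linear_continuous_on T)
    then show ?thesis
      by (intro continuous_intros)
  qed
  ultimately show ?thesis
    unfolding C2_on_def by (intro exI) (auto simp: vimage_def)
qed

lemma C2_on_diff_const:
  assumes "C2_on S F"
  shows "C2_on S (\<lambda>x. F x - c)"
proof -
  have "((\<lambda>x. F x - c) has_derivative d) (at x)" if "(F has_derivative d) (at x)" for d x
    using has_derivative_diff[OF that has_derivative_const[of c]] by simp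
  then show ?thesis
    using assms unfolding C2_on_def by blast
qed

text \<open>Differentiability of \<open>D1\<close> at \<open>a\<close> makes the first derivative
  deviate from \<open>D1 a\<close> by at most a multiple of norm (y - a). The mean value inequality
  on the ball of radius norm (x - a) contributes the second factor norm (x - a).\<close>

lemma C2_on_quadratic_remainder:
  fixes F :: "'a::real_normed_vector \<Rightarrow> 'b::real_normed_vector"
  assumes F: "C2_on S F" and S: "open S" "a \<in> S" and F': "(F has_derivative F') (at a)"
  shows "\<exists>M>0. \<exists>r>0. \<forall>x. norm (x - a) < r \<longrightarrow>
           norm (F x - F a - F' (x - a)) \<le> M * (norm (x - a))\<^sup>2"
proof -
  obtain D1 D2 where
    D1: "\<And>x. x \<in> S \<Longrightarrow> (F has_derivative blinfun_apply (D1 x)) (at x)" and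
    D2: "\<And>x. x \<in> S \<Longrightarrow> (D1 has_derivative blinfun_apply (D2 x)) (at x)"
    using F unfolding C2_on_def by blast
  have F'_eq: "F' = blinfun_apply (D1 a)"
    using has_derivative_unique[OF F' D1[OF S(2)]] .
  obtain e where e: "e > 0" "ball a e \<subseteq> S"
    using S open_contains_ball by blast
  obtain d where d: "d > 0"
    "\<And>y. norm (y - a) < d \<Longrightarrow> norm (D1 y - D1 a - D2 a (y - a)) \<le> 1 * norm (y - a)"
    using D2[OF S(2)] unfolding has_derivative_at_alt by (meson zero_less_one)
  \<comment> \<open>The summand 1 is the tolerance chosen above for the linearization of
    \<open>D1\<close> at \<open>a\<close>.\<close>
  define M where "M = norm (D2 a) + 1"
  define r where "r = min d e"
  have lip: "norm (D1 y - D1 a) \<le> M * norm (y - a)" if "norm (y - a) < d" for y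
  proof -
    have "norm (D1 y - D1 a) \<le> norm (D1 y - D1 a - D2 a (y - a)) + norm (D2 a (y - a))"
      using norm_triangle_ineq[of "D1 y - D1 a - D2 a (y - a)" "D2 a (y - a)"] by simp
    also have "\<dots> \<le> 1 * norm (y - a) + norm (D2 a) * norm (y - a)"
      using d(2)[OF that] norm_blinfun[of "D2 a" "y - a"] by linarith
    finally show ?thesis
      by (simp add: M_def algebra_simps)
  qed
  have "norm (F x - F a - F' (x - a)) \<le> M * (norm (x - a))\<^sup>2" if x: "norm (x - a) < r" for x
  proof -
    have sub: "y \<in> S \<and> norm (y - a) < d" if "y \<in> cball a (norm (x - a))" for y
    proof -
      have "norm (y - a) \<le> norm (x - a)"
        using that by (simp add: dist_norm norm_minus_commute)
      then have "norm (y - a) < d" "norm (y - a) < e"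
        using x by (auto simp: r_def)
      then show ?thesis
        using e(2) by (auto simp: subset_iff dist_norm norm_minus_commute)
    qed
    have "norm (F x - F a - D1 a (x - a)) \<le> norm (x - a) * (M * norm (x - a))"
    proof (rule differentiable_bound_linearization[where S = "cball a (norm (x - a))"
          and f' = "\<lambda>y. blinfun_apply (D1 y)"])
      show "a + t *\<^sub>R (x - a) \<in> cball a (norm (x - a))" if "t \<in> {0..1}" for t
        using that by (simp add: dist_norm mult_left_le_one_le)
      show "(F has_derivative blinfun_apply (D1 y)) (at y within cball a (norm (x - a)))"
        if "y \<in> cball a (norm (x - a))" for y
        using D1 sub[OF that] has_derivative_at_withinI by blast
      show "onorm (blinfun_apply (D1 y) - blinfun_apply (D1 a)) \<le> M * norm (x - a)"
        if y: "y \<in> cball a (norm (x - a))" for y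
      proof -
        have "onorm (blinfun_apply (D1 y) - blinfun_apply (D1 a)) = norm (D1 y - D1 a)"
          by (simp add: norm_blinfun.rep_eq minus_blinfun.rep_eq fun_diff_def)
        also have "\<dots> \<le> M * norm (y - a)"
          using lip sub[OF y] by blast
        also have "\<dots> \<le> M * norm (x - a)"
          using y by (intro mult_left_mono) (auto simp: M_def dist_norm norm_minus_commute)
        finally show ?thesis .
      qed
    qed auto
    then show ?thesis
      by (simp add: F'_eq power2_eq_square algebra_simps)
  qed
  moreover have "M > 0" "r > 0"
    using d(1) e(1) by (auto simp: M_def r_def add_nonneg_pos)
  ultimately show ?thesis
    by blast
qed

section \<open>Gradients of real functions\<close>

lemma linear_real_eq_inner:
  fixes D :: "real^'n \<Rightarrow> real"
  assumes "linear D"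
  shows "D h = h \<bullet> (\<chi> i. D (axis i 1))"
proof -
  have "D h = D (\<Sum>i\<in>UNIV. h $ i *\<^sub>R axis i 1)"
    by (simp add: basis_expansion flip: scalar_mult_eq_scaleR)
  also have "\<dots> = h \<bullet> (\<chi> i. D (axis i 1))"
    by (simp add: linear_sum[OF assms] linear_cmul[OF assms] inner_vec_def)
  finally show ?thesis .
qed

text \<open>Since \<open>grad\<close> is defined by choice, its value is only determined once the
  gradient vector is shown to be unique, which follows from uniqueness of the Frechet
  derivative.\<close>

lemma grad_eqI:
  assumes "(\<phi> has_derivative D) (at x)"
  shows "grad \<phi> x = (\<chi> i. D (axis i 1))"
proof -
  have "D = (\<lambda>h. h \<bullet> (\<chi> i. D (axis i 1)))"
    using linear_real_eq_inner[OF has_derivative_linear[OF assms]] by (rule ext)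
  then have *: "GDERIV \<phi> x :> (\<chi> i. D (axis i 1))"
    unfolding gderiv_def by (rule subst) (rule assms)
  have "d = (\<chi> i. D (axis i 1))" if "GDERIV \<phi> x :> d" for d
  proof -
    have "(\<lambda>h. h \<bullet> d) = (\<lambda>h. h \<bullet> (\<chi> i. D (axis i 1)))"
      using that * unfolding gderiv_def by (rule has_derivative_unique)
    then show ?thesis
      by (metis inner_commute vector_eq_ldot)
  qed
  then show ?thesis
    unfolding grad_def using * by (rule some_equality[rotated])
qed

lemma has_derivative_grad:
  assumes "(\<phi> has_derivative D) (at x)"
  shows "D = (\<lambda>h. grad \<phi> x \<bullet> h)"
  unfolding grad_eqI[OF assms]
  by (rule ext, subst inner_commute, rule linear_real_eq_inner[OF has_derivative_linear[OF assms]])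

text \<open>This makes \<open>hessian\<close> meaningful at the point. On the open set
  \<open>S\<close> the gradient is the image of \<open>D1\<close> under the bounded linear map
  listing the values of a functional on the axes, so differentiability carries over from
  \<open>D1\<close>.\<close>

lemma C2_on_imp_twice_differentiable_at:
  assumes C2: "C2_on S \<phi>" and S: "open S" "x \<in> S"
  shows "twice_differentiable_at \<phi> x"
proof -
  obtain D1 D2 where
    D1: "\<And>x. x \<in> S \<Longrightarrow> (\<phi> has_derivative blinfun_apply (D1 x)) (at x)" and
    D2: "\<And>x. x \<in> S \<Longrightarrow> (D1 has_derivative blinfun_apply (D2 x)) (at x)"
    using C2 unfolding C2_on_def by blast
  have "\<forall>\<^sub>F y in nhds x. \<phi> differentiable (at y)"
    using S D1 unfolding eventually_nhds differentiable_def by blast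
  moreover have "grad \<phi> differentiable (at x)"
  proof -
    have "bounded_linear (\<lambda>L :: (real^'n) \<Rightarrow>\<^sub>L real. \<chi> i. blinfun_apply L (axis i 1))"
    proof -
      \<comment> \<open>Written as a finite sum of evaluations, the map is visibly bounded linear;
        the vector form is recovered by expansion in the standard basis.\<close>
      have "bounded_linear (\<lambda>L :: (real^'n) \<Rightarrow>\<^sub>L real. \<Sum>i\<in>UNIV. L (axis i 1) *\<^sub>R axis i (1::real) :: real^'n)"
        by (intro bounded_linear_intros)
      moreover have "(\<Sum>i\<in>UNIV. L (axis i 1) *\<^sub>R axis i 1) = (\<chi> i. L (axis i 1))"
        for L :: "(real^'n) \<Rightarrow>\<^sub>L real"
        using basis_expansion[of "\<chi> i. L (axis i 1)"] by (simp add: scalar_mult_eq_scaleR)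
      ultimately show ?thesis
        by simp
    qed
    from bounded_linear.has_derivative[OF this D2[OF S(2)]]
    have "((\<lambda>y. \<chi> i. blinfun_apply (D1 y) (axis i 1)) has_derivative
        (\<lambda>h. \<chi> i. blinfun_apply (D2 x h) (axis i 1))) (at x)" .
    then have "(grad \<phi> has_derivative (\<lambda>h. \<chi> i. blinfun_apply (D2 x h) (axis i 1))) (at x)"
      using S by (rule has_derivative_transform_within_open) (simp add: grad_eqI[OF D1])
    then show ?thesis
      unfolding differentiable_def by blast
  qed
  ultimately show ?thesis
    unfolding twice_differentiable_at_def by blast
qed

section \<open>Bilinear forms and Schur stable matrices\<close>

lemma matrix_form_bounded:
  fixes M :: "real^'n^'m"
  obtains C where "C > 0" "\<And>x y. \<bar>x \<bullet> (M *v y)\<bar> \<le> C * norm x * norm y"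
proof
  \<comment> \<open>Adding 1 keeps the constant positive even for the zero matrix.\<close>
  define C where "C = onorm ((*v) M) + 1"
  have bl: "bounded_linear ((*v) M)"
    by simp
  show "C > 0"
    using onorm_pos_le[OF bl] by (simp add: C_def)
  show "\<bar>x \<bullet> (M *v y)\<bar> \<le> C * norm x * norm y" for x y
  proof -
    have "\<bar>x \<bullet> (M *v y)\<bar> \<le> norm x * norm (M *v y)"
      by (rule Cauchy_Schwarz_ineq2)
    also have "\<dots> \<le> norm x * (C * norm y)"
    proof (rule mult_left_mono)
      have "norm (M *v y) \<le> onorm ((*v) M) * norm y"
        using onorm[OF bl] .
      also have "\<dots> \<le> C * norm y"
        by (intro mult_right_mono) (auto simp: C_def)
      finally show "norm (M *v y) \<le> C * norm y" .
    qed simp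
    finally show ?thesis
      by (simp add: mult_ac)
  qed
qed

text \<open>The constant is the minimum of the form on the unit sphere, attained by compactness;
  homogeneity of degree two extends the bound to all vectors.\<close>

lemma pos_def_coercive:
  assumes "pos_def M"
  obtains c where "c > 0" "\<And>x. c * (norm x)\<^sup>2 \<le> x \<bullet> (M *v x)"
proof -
  have cont: "continuous_on (sphere 0 1) (\<lambda>x. x \<bullet> (M *v x))"
    by (intro continuous_intros linear_continuous_on) simp
  have ne: "sphere (0 :: real^'a) 1 \<noteq> {}"
    by simp
  obtain x0 where x0: "x0 \<in> sphere 0 1" "\<And>y. y \<in> sphere 0 1 \<Longrightarrow> x0 \<bullet> (M *v x0) \<le> y \<bullet> (M *v y)"
    using continuous_attains_inf[OF compact_sphere ne cont] by blast
  show ?thesis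
  proof
    have "x0 \<noteq> 0"
      using x0(1) by auto
    then show "0 < x0 \<bullet> (M *v x0)"
      using assms unfolding pos_def_def by blast
    show "x0 \<bullet> (M *v x0) * (norm x)\<^sup>2 \<le> x \<bullet> (M *v x)" for x
    proof (cases "x = 0")
      case False
      define y where "y = (1 / norm x) *\<^sub>R x"
      have x: "x = norm x *\<^sub>R y" and y: "y \<in> sphere 0 1"
        using False by (auto simp: y_def)
      have "x \<bullet> (M *v x) = (norm x)\<^sup>2 * (y \<bullet> (M *v y))"
        by (subst x, subst (2) x) (simp add: matrix_vector_mult_scaleR power2_eq_square)
      then show ?thesis
        using mult_left_mono[OF x0(2)[OF y], of "(norm x)\<^sup>2"] by (simp add: mult.commute)
    qed simp
  qed
qed

text \<open>A kernel vector of I - M is fixed by M. If nonzero, its complexification would be an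
  eigenvector for the eigenvalue 1, which has modulus 1. The result gives meaning to the inverse
  that defines \<open>p\<close>.\<close>

lemma schur_stable_invertible:
  fixes M :: "real^'n^'n"
  assumes "schur_stable M"
  shows "invertible (mat 1 - M)"
proof -
  have "x = 0" if x: "(mat 1 - M) *v x = 0" for x
  proof (rule ccontr)
    assume "x \<noteq> 0"
    define v :: "complex^'n" where "v = (\<chi> i. complex_of_real (x $ i))"
    have Mx: "M *v x = x"
      using x by (simp add: matrix_vector_mult_diff_rdistrib)
    have "(\<chi> i j. complex_of_real (M $ i $ j)) *v v = 1 *s v"
    proof (rule vec_eq_iff[THEN iffD2], rule)
      fix i
      have "((\<chi> i j. complex_of_real (M $ i $ j)) *v v) $ i = complex_of_real ((M *v x) $ i)"
        by (simp add: matrix_vector_mult_def v_def)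
      then show "((\<chi> i j. complex_of_real (M $ i $ j)) *v v) $ i = (1 *s v) $ i"
        by (simp add: Mx v_def)
    qed
    moreover have "v \<noteq> 0"
      using \<open>x \<noteq> 0\<close> by (auto simp: v_def vec_eq_iff)
    ultimately have "eigenvalue M 1"
      unfolding eigenvalue_def by blast
    then show False
      using assms unfolding schur_stable_def by force
  qed
  then show ?thesis
    by (simp add: invertible_left_inverse matrix_left_invertible_ker)
qed

section \<open>Comparison functions and one-step changes of quadratic functions\<close>

lemma class_K_inf_quadratic:
  assumes "c > 0"
  shows "class_K_inf (\<lambda>s. c * s\<^sup>2)"
proof -
  have "strict_mono_on {0..} (\<lambda>s::real. c * s\<^sup>2)"
    using assms by (auto simp: strict_mono_on_def intro: power_strict_mono)
  moreover have "filterlim (\<lambda>s::real. c * s\<^sup>2) at_top at_top"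
    using assms
    by (intro filterlim_tendsto_pos_mult_at_top[OF tendsto_const] filterlim_pow_at_top filterlim_ident) auto
  ultimately show ?thesis
    unfolding class_K_inf_def by (auto intro!: continuous_intros)
qed

text \<open>Write G x = A x + d with d quadratically small. The Lyapunov equation makes the linear
  part decrease the form by exactly x'Qx, which is at least k times the squared norm. The terms in d
  are of third order, and near 0 they consume at most half of this.\<close>

lemma lyapunov_equation_local_decrease:
  fixes A P Q :: "real^'n^'n" and G :: "real^'n \<Rightarrow> real^'n"
  assumes P: "transpose P = P" and Q: "pos_def Q"
    and eq: "transpose A ** P ** A - P + Q = 0"
    and M: "M > 0"
    and G: "\<And>x. norm x < r \<Longrightarrow> norm (G x - A *v x) \<le> M * (norm x)\<^sup>2" and r: "r > 0"
  obtains c \<rho> where "c > 0" "\<rho> > 0" "\<rho> \<le> 1" "\<rho> < r"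
    "\<And>x. norm x \<le> \<rho> \<Longrightarrow> G x \<bullet> (P *v G x) \<le> x \<bullet> (P *v x) - c * (norm x)\<^sup>2"
proof -
  obtain k where k: "k > 0" "\<And>x. k * (norm x)\<^sup>2 \<le> x \<bullet> (Q *v x)"
    using pos_def_coercive[OF Q] by blast
  obtain C1 where C1: "C1 > 0" "\<And>x y. \<bar>x \<bullet> (P *v y)\<bar> \<le> C1 * norm x * norm y"
    using matrix_form_bounded[of P] by blast
  obtain C2 where C2: "C2 > 0" "\<And>x y. \<bar>x \<bullet> ((P ** A) *v y)\<bar> \<le> C2 * norm x * norm y"
    using matrix_form_bounded[of "P ** A"] by blast
  \<comment> \<open>\<open>E\<close> is the coefficient of the cubic error: the first summand comes
    from the two equal cross terms, the second from the form at d.\<close>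
  define E where "E = 2 * C2 * M + C1 * M\<^sup>2"
  have E: "E > 0"
    using C1(1) C2(1) M by (simp add: E_def add_pos_pos)
  \<comment> \<open>The bound 1 allows s^4 to be replaced by s^3, \<open>r / 2\<close> keeps
    strictly inside the range of the remainder estimate, and \<open>k / (2 * E)\<close> gives E s
    \<le> k / 2.\<close>
  define \<rho> where "\<rho> = min (min 1 (r / 2)) (k / (2 * E))"
  have "G x \<bullet> (P *v G x) \<le> x \<bullet> (P *v x) - k / 2 * (norm x)\<^sup>2" if x: "norm x \<le> \<rho>" for x
  proof -
    define s where "s = norm x"
    define d where "d = G x - A *v x"
    have s: "0 \<le> s" "s \<le> 1" "s < r" "s \<le> k / (2 * E)"
      using x r by (auto simp: s_def \<rho>_def)
    have d: "norm d \<le> M * s\<^sup>2"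
      using G[of x] s(3) by (simp add: d_def s_def)
    have sym: "u \<bullet> (P *v v) = v \<bullet> (P *v u)" for u v
      by (metis P dot_lmul_matrix inner_commute transpose_matrix_vector)
    have AA: "(A *v x) \<bullet> (P *v (A *v x)) = x \<bullet> (P *v x) - x \<bullet> (Q *v x)"
    proof -
      have "(A *v x) \<bullet> (P *v (A *v x)) = x \<bullet> ((transpose A ** P ** A) *v x)"
        by (metis dot_lmul_matrix inner_commute matrix_vector_mul_assoc transpose_matrix_vector
            transpose_transpose)
      also have "transpose A ** P ** A = P - Q"
        using eq by (simp add: algebra_simps)
      finally show ?thesis
        by (simp add: matrix_vector_mult_diff_rdistrib inner_diff_right)
    qed
    have "G x = A *v x + d"
      by (simp add: d_def)
    then have "G x \<bullet> (P *v G x) = (A *v x) \<bullet> (P *v (A *v x)) + 2 * (d \<bullet> (P *v (A *v x))) + d \<bullet> (P *v d)"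
      using sym[of "A *v x" d] by (simp add: matrix_vector_right_distrib inner_add_left inner_add_right)
    also have "\<dots> = x \<bullet> (P *v x) - x \<bullet> (Q *v x) + 2 * (d \<bullet> ((P ** A) *v x)) + d \<bullet> (P *v d)"
      by (simp only: AA) (simp add: matrix_vector_mul_assoc)
    also have "\<dots> \<le> x \<bullet> (P *v x) - k * s\<^sup>2 + 2 * (C2 * M * s ^ 3) + C1 * M\<^sup>2 * s ^ 3"
    proof -
      have "d \<bullet> ((P ** A) *v x) \<le> C2 * norm d * s"
        using C2(2)[of d x] by (simp add: s_def)
      also have "\<dots> \<le> C2 * (M * s\<^sup>2) * s"
        using C2(1) d s(1) by (intro mult_right_mono mult_left_mono) auto
      finally have 1: "d \<bullet> ((P ** A) *v x) \<le> C2 * M * s ^ 3"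
        by (simp add: power2_eq_square power3_eq_cube mult_ac)
      have "d \<bullet> (P *v d) \<le> C1 * (norm d)\<^sup>2"
        using C1(2)[of d d] by (simp add: power2_eq_square mult_ac)
      also have "\<dots> \<le> C1 * (M * s\<^sup>2)\<^sup>2"
        using C1(1) d by (intro mult_left_mono power_mono) auto
      also have "\<dots> = C1 * M\<^sup>2 * s ^ 4"
        by (simp add: power_mult_distrib flip: power_mult)
      also have "\<dots> \<le> C1 * M\<^sup>2 * s ^ 3"
        using C1(1) s by (intro mult_left_mono power_decreasing) auto
      finally have 2: "d \<bullet> (P *v d) \<le> C1 * M\<^sup>2 * s ^ 3" .
      show ?thesis
        using 1 2 k(2)[of x] unfolding s_def by linarith
    qed
    also have "\<dots> = x \<bullet> (P *v x) - k * s\<^sup>2 + (E * s) * s\<^sup>2"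
      by (simp add: E_def power2_eq_square power3_eq_cube algebra_simps)
    also have "\<dots> \<le> x \<bullet> (P *v x) - k * s\<^sup>2 + k / 2 * s\<^sup>2"
      using s(4) E by (intro add_left_mono mult_right_mono) (auto simp: field_simps)
    also have "\<dots> = x \<bullet> (P *v x) - k / 2 * s\<^sup>2"
      by simp
    finally show ?thesis
      by (simp add: s_def)
  qed
  moreover have "\<rho> > 0" "\<rho> \<le> 1" "\<rho> < r" "k / 2 > 0"
    using k(1) r E by (auto simp: \<rho>_def min_less_iff_disj)
  ultimately show ?thesis
    using that by blast
qed

text \<open>Only the linear part of the cost needs a first-order expansion. The form of
  \<open>P\<close>, of whatever sign, is of second order at both x and G x, because the norm of G x
  is at most a multiple of that of x.\<close>

lemma quadratic_cost_increment:
  fixes A P :: "real^'n^'n" and G :: "real^'n \<Rightarrow> real^'n" and p :: "real^'n"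
  assumes M: "M > 0" and \<rho>: "\<rho> \<le> 1"
    and G: "\<And>x. norm x \<le> \<rho> \<Longrightarrow> norm (G x - A *v x) \<le> M * (norm x)\<^sup>2"
  obtains C where "C \<ge> 0"
    "\<And>x. norm x \<le> \<rho> \<Longrightarrow>
       G x \<bullet> (P *v G x) + p \<bullet> G x \<le> x \<bullet> (P *v x) + p \<bullet> x + p \<bullet> (A *v x - x) + C * (norm x)\<^sup>2"
proof -
  obtain C1 where C1: "C1 > 0" "\<And>x y. \<bar>x \<bullet> (P *v y)\<bar> \<le> C1 * norm x * norm y"
    using matrix_form_bounded[of P] by blast
  define a where "a = onorm ((*v) A)"
  have a: "a \<ge> 0" "\<And>x. norm (A *v x) \<le> a * norm x"
    by (simp_all add: a_def onorm onorm_pos_le)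
  \<comment> \<open>The summands bound, in order, the form at G x, the form at x with its sign
    reversed, and the effect of the remainder of G on the linear term.\<close>
  define C where "C = C1 * (a + M)\<^sup>2 + C1 + norm p * M"
  have "G x \<bullet> (P *v G x) + p \<bullet> G x \<le> x \<bullet> (P *v x) + p \<bullet> x + p \<bullet> (A *v x - x) + C * (norm x)\<^sup>2"
    if x: "norm x \<le> \<rho>" for x
  proof -
    have s: "norm x \<le> 1"
      using x \<rho> by linarith
    have "norm (G x) \<le> norm (A *v x) + norm (G x - A *v x)"
      using norm_triangle_ineq[of "A *v x" "G x - A *v x"] by simp
    also have "\<dots> \<le> a * norm x + M * (norm x)\<^sup>2"
      using a(2) G[OF x] by (rule add_mono)
    also have "\<dots> \<le> a * norm x + M * norm x"
      using M s by (simp add: power2_eq_square mult_left_le)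
    finally have Gx: "norm (G x) \<le> (a + M) * norm x"
      by (simp add: algebra_simps)
    have "G x \<bullet> (P *v G x) \<le> C1 * (norm (G x))\<^sup>2"
      using C1(2)[of "G x" "G x"] by (simp add: power2_eq_square mult_ac)
    also have "\<dots> \<le> C1 * ((a + M) * norm x)\<^sup>2"
      using C1(1) Gx by (intro mult_left_mono power_mono) auto
    finally have 1: "G x \<bullet> (P *v G x) \<le> C1 * (a + M)\<^sup>2 * (norm x)\<^sup>2"
      by (simp add: power_mult_distrib)
    have 2: "- (C1 * (norm x)\<^sup>2) \<le> x \<bullet> (P *v x)"
      using C1(2)[of x x] by (simp add: power2_eq_square mult_ac)
    have "p \<bullet> (G x - A *v x) \<le> norm p * norm (G x - A *v x)"
      by (rule norm_cauchy_schwarz)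
    also have "\<dots> \<le> norm p * (M * (norm x)\<^sup>2)"
      using G[OF x] by (rule mult_left_mono) simp
    finally have 3: "p \<bullet> (G x - A *v x) \<le> norm p * M * (norm x)\<^sup>2"
      by (simp add: mult_ac)
    show ?thesis
      using 1 2 3 by (simp add: C_def inner_diff_right algebra_simps)
  qed
  moreover have "C \<ge> 0"
    using C1(1) M by (simp add: C_def)
  ultimately show ?thesis
    using that by blast
qed

section \<open>Terminal set, Lyapunov function and terminal cost of the closed loop\<close>

theorem lemma13:
  fixes f :: "real^'n \<Rightarrow> real^'m \<Rightarrow> real^'q \<Rightarrow> real^'n"
    and X :: "(real^'n) set" and U :: "(real^'m) set" and W :: "(real^'q) set"
    and l l\<^sub>e g :: "real^'n \<Rightarrow> real^'m \<Rightarrow> real" and lam :: real and N :: nat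
    and Zg :: "((real^'n) \<times> (real^'m)) set"
    and A A\<^sub>K Qs Ps :: "real^'n^'n" and B :: "real^'m^'n" and K :: "real^'n^'m"
    and Vs lbar :: "real^'n \<Rightarrow> real" and q p :: "real^'n"
    and Xf :: "real \<Rightarrow> (real^'n) set" and admissible :: "real \<Rightarrow> bool"
  assumes f_maps: "\<And>x u w. x \<in> X \<Longrightarrow> u \<in> U \<Longrightarrow> w \<in> W \<Longrightarrow> f x u w \<in> X"
    and W_0: "0 \<in> W"
    and l_def: "l = (\<lambda>x u. l\<^sub>e x u + lam * max (g x u) 0)"
    and le_cont: "continuous_on (X \<times> U) (\<lambda>(x, u). l\<^sub>e x u)"
    and g_cont: "continuous_on (X \<times> U) (\<lambda>(x, u). g x u)"
    and lam_pos: "lam > 0"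
    and Zg_def: "Zg = {(x, u). x \<in> X \<and> u \<in> U \<and> g x u \<le> 0}"
    and N: "N \<ge> 1"
    and f_cont: "continuous_on (X \<times> U \<times> W) (\<lambda>(x, u, w). f x u w)"
    and l_cont: "continuous_on (X \<times> U) (\<lambda>(x, u). l x u)"
    and U_compact: "compact U"
    and X_closed: "closed X"
    and origin: "(0, 0) \<in> X \<times> U"
    and steady: "f 0 0 0 = 0"
    and f_C2: "C2_on (interior Zg) (\<lambda>(x, u). f x u 0)"
    and l_C2: "C2_on (interior Zg) (\<lambda>(x, u). l x u)"
    and A_def: "A = jacobian (\<lambda>x. f x 0 0) (at 0)"
    and B_def: "B = jacobian (\<lambda>u. f 0 u 0) (at 0)"
    and stab: "stabilizable A B"
    and U_int: "0 \<in> interior U"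
    and Zg_int: "(0, 0) \<in> interior Zg"
    and AK_def: "A\<^sub>K = A + B ** K"
    and AK_schur: "schur_stable A\<^sub>K"
    and Qs_pos: "pos_def Qs"
    and Ps_pos: "pos_def Ps"
    and Ps_eq: "transpose A\<^sub>K ** Ps ** A\<^sub>K - Ps + Qs = 0"
    and Vs_def: "Vs = (\<lambda>x. x \<bullet> (Ps *v x))"
    and Xf_def: "Xf = (\<lambda>\<tau>. {x \<in> X. Vs x \<le> \<tau>})"
    and admissible_def:
      "admissible = (\<lambda>\<tau>. \<tau> > 0 \<and> (\<forall>x\<in>Xf \<tau>. K *v x \<in> U \<and> (x, K *v x) \<in> Zg))"
    and feasible_bounded:
      "\<And>\<tau>. admissible \<tau> \<Longrightarrow> bounded (feasible_set f X U N (Xf \<tau>))"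
    and lbar_def: "lbar = (\<lambda>x. l x (K *v x) - l 0 0)"
    and q_def: "q = grad lbar 0"
    and p_def: "p = q v* matrix_inv (mat 1 - A\<^sub>K)"
  shows "\<exists>\<tau>. admissible \<tau> \<and> (\<forall>x\<in>Xf \<tau>. twice_differentiable_at lbar x) \<and>
           (\<forall>Q P :: real^'n^'n.
              transpose Q = Q \<longrightarrow>
              (\<forall>x\<in>Xf \<tau>. 0 \<le> x \<bullet> ((Q - hessian lbar x) *v x)) \<longrightarrow>
              transpose A\<^sub>K ** P ** A\<^sub>K - P + Q = 0 \<longrightarrow>
              (\<exists>\<mu>\<ge>0. robust_terminal_condition f X U l (\<lambda>x. K *v x) Vs (Xf \<tau>)
                        (\<lambda>x. \<mu> * Vs x + (x \<bullet> (P *v x) + p \<bullet> x))))"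
proof -
  \<comment> \<open>Pulling back along \<open>T\<close> turns smoothness on the interior of
    \<open>Zg\<close> into smoothness of the closed loop and of \<open>lbar\<close> on the open
    neighbourhood \<open>O1\<close> of 0.\<close>
  define T where "T x = (x, K *v x)" for x
  have T: "bounded_linear T"
    unfolding T_def by (intro bounded_linear_Pair bounded_linear_ident) simp
  define O1 where "O1 = T -` interior Zg"
  have O1: "open O1" "0 \<in> O1"
    using T Zg_int
    by (auto simp: O1_def T_def[of 0] intro: open_vimage linear_continuous_on continuous_on_eq_continuous_within)
  define G where "G x = f x (K *v x) 0" for x
  have G_C2: "C2_on O1 G"
    using C2_on_compose_bounded_linear[OF f_C2 T] by (simp add: O1_def T_def G_def [abs_def])
  have lbar_C2: "C2_on O1 lbar"
    using C2_on_diff_const[OF C2_on_compose_bounded_linear[OF l_C2 T], of "l 0 0"]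
    by (simp add: O1_def T_def lbar_def)
  have G0: "G 0 = 0" and lbar0: "lbar 0 = 0"
    by (simp_all add: G_def steady lbar_def)

  \<comment> \<open>\<open>A\<close> and \<open>B\<close> are Jacobians of partial maps, so they are
    identified as the restrictions of one joint derivative \<open>D\<close> to the two factors.
    Linearity of \<open>D\<close> then gives D (h, K h) = (A + B K) h.\<close>
  obtain D where D: "((\<lambda>(x, u). f x u 0) has_derivative D) (at (0, 0))"
    using f_C2 Zg_int unfolding C2_on_def by blast
  have D_lin: "linear D"
    using D has_derivative_linear by blast
  have "((\<lambda>x. (x, 0)) has_derivative (\<lambda>h. (h, 0))) (at 0)"
    by (rule has_derivative_Pair[OF has_derivative_ident has_derivative_const])
  from has_derivative_compose[OF this D]
  have "((\<lambda>x. f x 0 0) has_derivative (\<lambda>h. D (h, 0))) (at 0)"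
    by simp
  then have DA: "A *v h = D (h, 0)" for h
    unfolding A_def jacobian_def
    by (metis frechet_derivative_at has_derivative_linear matrix_works linear_matrix_vector_mul_eq)
  have "((\<lambda>u. (0, u)) has_derivative (\<lambda>h. (0, h))) (at 0)"
    by (rule has_derivative_Pair[OF has_derivative_const has_derivative_ident])
  from has_derivative_compose[OF this D]
  have "((\<lambda>u. f 0 u 0) has_derivative (\<lambda>h. D (0, h))) (at 0)"
    by simp
  then have DB: "B *v h = D (0, h)" for h
    unfolding B_def jacobian_def
    by (metis frechet_derivative_at has_derivative_linear matrix_works linear_matrix_vector_mul_eq)
  have "(G has_derivative (\<lambda>h. D (h, K *v h))) (at 0)"
    using has_derivative_compose[OF bounded_linear_imp_has_derivative[OF T], of "\<lambda>(x, u). f x u 0" D 0 UNIV] D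
    by (simp add: T_def G_def [abs_def])
  moreover have "D (h, K *v h) = A\<^sub>K *v h" for h
    using linear_add[OF D_lin, of "(h, 0)" "(0, K *v h)"]
    by (simp add: AK_def matrix_vector_mult_add_rdistrib DA DB flip: matrix_vector_mul_assoc)
  ultimately have G': "(G has_derivative (\<lambda>h. A\<^sub>K *v h)) (at 0)"
    by simp
  obtain M r where M: "M > 0" and r: "r > 0"
    and Gr: "\<And>x. norm x < r \<Longrightarrow> norm (G x - A\<^sub>K *v x) \<le> M * (norm x)\<^sup>2"
    using C2_on_quadratic_remainder[OF G_C2 O1 G'] by (auto simp: G0)

  obtain L where "(lbar has_derivative L) (at 0)"
    using lbar_C2 O1 unfolding C2_on_def by blast
  then have "(lbar has_derivative (\<lambda>h. q \<bullet> h)) (at 0)"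
    unfolding q_def using has_derivative_grad by metis
  from C2_on_quadratic_remainder[OF lbar_C2 O1 this]
  obtain M2 r2 where M2: "M2 > 0" and r2: "r2 > 0"
    and lr: "\<And>x. norm x < r2 \<Longrightarrow> \<bar>lbar x - q \<bullet> x\<bar> \<le> M2 * (norm x)\<^sup>2"
    by (auto simp: lbar0)
  obtain r3 where r3: "r3 > 0" "ball 0 r3 \<subseteq> O1"
    using O1 open_contains_ball by blast

  have p: "p \<bullet> (A\<^sub>K *v x - x) = - (q \<bullet> x)" for x
  proof -
    \<comment> \<open>\<open>matrix_inv\<close> is a choice; invertibility guarantees that the
      chosen matrix is a genuine inverse.\<close>
    have "matrix_inv (mat 1 - A\<^sub>K) ** (mat 1 - A\<^sub>K) = mat 1"
      using schur_stable_invertible[OF AK_schur]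
        someI_ex[of "\<lambda>B. (mat 1 - A\<^sub>K) ** B = mat 1 \<and> B ** (mat 1 - A\<^sub>K) = mat 1"]
      unfolding invertible_def matrix_inv_def by blast
    then have "p \<bullet> ((mat 1 - A\<^sub>K) *v x) = q \<bullet> x"
      by (simp add: p_def dot_lmul_matrix matrix_vector_mul_assoc)
    then show ?thesis
      by (simp add: matrix_vector_mult_diff_rdistrib inner_diff_right)
  qed

  have Ps_sym: "transpose Ps = Ps"
    using Ps_pos by (simp add: pos_def_def)
  \<comment> \<open>Within this radius the remainder estimates for \<open>G\<close> and
    \<open>lbar\<close> hold and points lie in \<open>O1\<close>.\<close>
  define r0 where "r0 = min r (min r2 r3)"
  obtain c \<rho> where c: "c > 0" and \<rho>: "\<rho> > 0" "\<rho> \<le> 1" "\<rho> < r0"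
    and dec: "\<And>x. norm x \<le> \<rho> \<Longrightarrow> G x \<bullet> (Ps *v G x) \<le> x \<bullet> (Ps *v x) - c * (norm x)\<^sup>2"
    using lyapunov_equation_local_decrease[OF Ps_sym Qs_pos Ps_eq M, of r0 G] Gr r r2 r3(1)
    by (auto simp: r0_def)
  obtain k where k: "k > 0" "\<And>x. k * (norm x)\<^sup>2 \<le> Vs x"
    using pos_def_coercive[OF Ps_pos] unfolding Vs_def by blast
  obtain k2 where k2: "k2 > 0" "\<And>x y. \<bar>x \<bullet> (Ps *v y)\<bar> \<le> k2 * norm x * norm y"
    using matrix_form_bounded[of Ps] by blast
  \<comment> \<open>By coercivity of \<open>Vs\<close> with constant \<open>k\<close>, this level
    confines the terminal set to the ball of radius \<open>\<rho>\<close>.\<close>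
  define \<tau> where "\<tau> = k * \<rho>\<^sup>2"
  have small: "norm x \<le> \<rho>" if "x \<in> Xf \<tau>" for x
  proof -
    have "k * (norm x)\<^sup>2 \<le> k * \<rho>\<^sup>2"
      using that k(2)[of x] by (simp add: Xf_def \<tau>_def)
    then show ?thesis
      using k(1) \<rho>(1) by (simp add: power2_le_iff_abs_le)
  qed
  have in_O1: "x \<in> O1" if "x \<in> Xf \<tau>" for x
    using small[OF that] \<rho>(3) r3(2) by (auto simp: r0_def subset_iff)
  have Zg: "(x, K *v x) \<in> Zg" if "x \<in> Xf \<tau>" for x
    using in_O1[OF that] interior_subset by (auto simp: O1_def T_def)
  have U: "K *v x \<in> U" if "x \<in> Xf \<tau>" for x
    using Zg[OF that] by (simp add: Zg_def)
  have adm: "admissible \<tau>"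
    unfolding admissible_def using U Zg k(1) \<rho>(1) by (simp add: \<tau>_def)
  have twice: "twice_differentiable_at lbar x" if "x \<in> Xf \<tau>" for x
    using C2_on_imp_twice_differentiable_at[OF lbar_C2 O1(1) in_O1[OF that]] .
  have Vs_dec: "Vs (G x) \<le> Vs x - c * (norm x)\<^sup>2" if "x \<in> Xf \<tau>" for x
    using dec[OF small[OF that]] by (simp add: Vs_def)
  \<comment> \<open>Decrease of \<open>Vs\<close> preserves the sublevel condition, while membership
    in \<open>X\<close> comes from the range of \<open>f\<close>, as K x lies in
    \<open>U\<close>.\<close>
  have inv: "positive_invariant G (Xf \<tau>)"
    unfolding positive_invariant_def
  proof
    fix x assume x: "x \<in> Xf \<tau>"
    have "Vs (G x) \<le> Vs x"
      using Vs_dec[OF x] c by (smt (verit) mult_nonneg_nonneg zero_le_power2)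
    moreover have "G x \<in> X"
      using x U[OF x] f_maps W_0 by (simp add: Xf_def G_def)
    ultimately show "G x \<in> Xf \<tau>"
      using x by (simp add: Xf_def)
  qed
  have cont: "continuous_on S (\<lambda>x. x \<bullet> (N *v x))" for S :: "(real^'n) set" and N :: "real^'n^'n"
    by (intro continuous_intros linear_continuous_on) simp
  have lyap: "lyapunov_function Vs G (Xf \<tau>) 0"
    unfolding lyapunov_function_def
  proof (intro conjI ballI exI)
    show "positive_invariant G (Xf \<tau>)"
      by (rule inv)
    show "0 \<le> Vs x" for x
      using k(1) k(2)[of x] by (smt (verit) mult_nonneg_nonneg zero_le_power2)
    show "class_K_inf (\<lambda>s. k * s\<^sup>2)" "class_K_inf (\<lambda>s. k2 * s\<^sup>2)" "class_K_inf (\<lambda>s. c * s\<^sup>2)"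
      using k(1) k2(1) c by (auto intro: class_K_inf_quadratic)
    show "k * (norm (x - 0))\<^sup>2 \<le> Vs x" for x
      using k(2) by simp
    show "Vs x \<le> k2 * (norm (x - 0))\<^sup>2" for x
      using k2(2)[of x x] by (simp add: Vs_def power2_eq_square mult_ac)
    show "Vs (G x) \<le> Vs x - c * (norm (x - 0))\<^sup>2" if "x \<in> Xf \<tau>" for x
      using Vs_dec[OF that] by simp
  qed
  have Xf0: "0 \<in> Xf \<tau>"
    using origin k(1) by (simp add: Xf_def Vs_def \<tau>_def)
  \<comment> \<open>\<open>\<tau>\<close> is already fixed here, so only \<open>\<mu>\<close> may
    depend on \<open>P\<close>, as the order of quantifiers demands.\<close>
  have main: "\<exists>\<mu>\<ge>0. robust_terminal_condition f X U l (\<lambda>x. K *v x) Vs (Xf \<tau>)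
      (\<lambda>x. \<mu> * Vs x + (x \<bullet> (P *v x) + p \<bullet> x))" for P :: "real^'n^'n"
  proof -
    obtain C where C: "C \<ge> 0" and inc: "\<And>x. norm x \<le> \<rho> \<Longrightarrow>
        G x \<bullet> (P *v G x) + p \<bullet> G x \<le> x \<bullet> (P *v x) + p \<bullet> x + p \<bullet> (A\<^sub>K *v x - x) + C * (norm x)\<^sup>2"
      using quadratic_cost_increment[OF M \<rho>(2), of G A\<^sub>K P p] Gr \<rho>(3) by (auto simp: r0_def)
    \<comment> \<open>The decrease of \<mu> Vs, at least \<mu> c times the squared norm, then pays
      exactly for both second-order errors: \<open>C\<close> from the increment of the economic part
      and \<open>M2\<close> from linearizing \<open>lbar\<close>.\<close>
    define \<mu> where "\<mu> = (C + M2) / c"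
    have \<mu>: "\<mu> \<ge> 0" "\<mu> * c = C + M2"
      using C M2 c by (simp_all add: \<mu>_def)
    have "\<mu> * Vs (G x) + (G x \<bullet> (P *v G x) + p \<bullet> G x)
        \<le> \<mu> * Vs x + (x \<bullet> (P *v x) + p \<bullet> x) - l x (K *v x) + l 0 0" if x: "x \<in> Xf \<tau>" for x
    proof -
      have "\<mu> * Vs (G x) \<le> \<mu> * (Vs x - c * (norm x)\<^sup>2)"
        using Vs_dec[OF x] \<mu>(1) by (rule mult_left_mono)
      also have "\<dots> = \<mu> * Vs x - (\<mu> * c) * (norm x)\<^sup>2"
        by (simp add: algebra_simps)
      finally have 1: "\<mu> * Vs (G x) \<le> \<mu> * Vs x - (C * (norm x)\<^sup>2 + M2 * (norm x)\<^sup>2)"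
        by (simp add: \<mu>(2) algebra_simps)
      have 2: "lbar x \<le> q \<bullet> x + M2 * (norm x)\<^sup>2"
        using lr[of x] small[OF x] \<rho>(3) by (simp add: r0_def abs_le_iff)
      \<comment> \<open>The first-order terms cancel by the identity for \<open>p\<close>, and the
        second-order ones by the choice of \<open>\<mu>\<close>.\<close>
      show ?thesis
        using 1 2 inc[OF small[OF x]] p[of x] by (simp add: lbar_def)
    qed
    then have "robust_terminal_condition f X U l (\<lambda>x. K *v x) Vs (Xf \<tau>)
        (\<lambda>x. \<mu> * Vs x + (x \<bullet> (P *v x) + p \<bullet> x))"
      unfolding robust_terminal_condition_def
      using inv lyap Xf0 U cont
      by (auto intro!: exI[of _ "Xf \<tau>"] continuous_intros simp: G_def [abs_def] Vs_def Xf_def)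
    then show ?thesis
      using \<mu>(1) by blast
  qed
  show ?thesis
    using adm twice main by blast
qed

end
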